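(* Let $\beta>1$ be a root of $x^d-a_{1}x^{d-1}+a_2x^{d-2}+\dots + (-1)^d a_d\in\mathbb{Z}[x]$ (that is, of $x^d+\sum_{i=1}^d(-1)^i a_i x^{d-i}$) with $a_i\ge 0$ for $i=1,\dots,d$, and $a_{1}\ge 2+\sum_{i=2}^{d} a_{i}$. Then $\beta$ has Property ($-$F).
   Context: For a real number $\beta>1$, set $\ell_\beta = \frac{-\beta}{\beta+1}$ and define the $(-\beta)$-transformation $T_{-\beta}: [\ell_\beta,\ell_\beta+1)\to[\ell_\beta,\ell_\beta+1)$ by $T_{-\beta}(x) = -\beta x - \lfloor -\beta x-\ell_\beta\rfloor$. For $x\in[\ell_\beta,\ell_\beta+1)$ let $d_{-\beta}(x)=x_1x_2x_3\cdots$ with $x_i = \lfloor -\beta T_{-\beta}^{i-1}(x)-\ell_\beta\rfloor\in\{0,1,\dots,\lfloor\beta\rfloor\}$, so that $x=\sum_{i\ge1} x_i(-\beta)^{-i}$. For $x\in\mathbb{R}$, let $k\ge 0$ be the minimal integer with $\frac{x}{(-\beta)^k}\in(\ell_\beta,\ell_\beta+1)$ and let $d_{-\beta}(\frac{x}{(-\beta)^k})=x_1x_2x_3\cdots$; the $(-\beta)$-expansion of $x$ is $x_1\cdots x_k\bullet x_{k+1}x_{k+2}\cdots$ if $k\ge1$ and $0\bullet x_1x_2\cdots$ if $k=0$. It is finite if only finitely many digits are nonzero, i.e. if $T_{-\beta}^n(\frac{x}{(-\beta)^k})=0$ for some $n\ge0$. The number $\beta$ has Property ($-$F) if each element of $\mathbb{Z}[\beta^{-1}]$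 has a finite $(-\beta)$-expansion. *)

theory Defs
  imports Complex_Main "HOL-Computational_Algebra.Polynomial"
begin

definition ell :: "real \<Rightarrow> real" where
  "ell \<beta> = - \<beta> / (\<beta> + 1)"

text \<open>The transformation is a total function on the reals; it is meant for arguments in
  \<open>{ell \<beta>..<ell \<beta> + 1}\<close>, an interval that it maps into itself.\<close>

definition neg_T :: "real \<Rightarrow> real \<Rightarrow> real" where
  "neg_T \<beta> x = - \<beta> * x - of_int \<lfloor>- \<beta> * x - ell \<beta>\<rfloor>"

lemma neg_T_range: "neg_T \<beta> x \<in> {ell \<beta>..<ell \<beta> + 1}"
  unfolding neg_T_def atLeastLessThan_iff by linarith

text \<open>Digits are indexed from 0: \<open>neg_digit \<beta> x i\<close> is the digit \<open>x\<^sub>i\<^sub>+\<^sub>1\<close>, the coefficient of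
  \<open>(-\<beta>)\<close> to the power \<open>-(i+1)\<close>.\<close>

definition neg_digit :: "real \<Rightarrow> real \<Rightarrow> nat \<Rightarrow> int" where
  "neg_digit \<beta> x i = \<lfloor>- \<beta> * (neg_T \<beta> ^^ i) x - ell \<beta>\<rfloor>"

definition neg_shift :: "real \<Rightarrow> real \<Rightarrow> nat" where
  "neg_shift \<beta> x = (LEAST k. x / (- \<beta>) ^ k \<in> {ell \<beta><..<ell \<beta> + 1})"

lemma neg_shift_exists:
  assumes "\<beta> > 1"
  shows "\<exists>k. x / (- \<beta>) ^ k \<in> {ell \<beta><..<ell \<beta> + 1}"
proof -
  have e: "ell \<beta> < 0" "ell \<beta> + 1 > 0"
    using assms by (auto simp: ell_def field_simps)
  have "(\<lambda>k. x * (inverse (- \<beta>)) ^ k) \<longlonglongrightarrow> x * 0"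
    using assms by (intro tendsto_intros LIMSEQ_power_zero) (auto simp: field_simps)
  then have "(\<lambda>k. x / (- \<beta>) ^ k) \<longlonglongrightarrow> 0"
    by (simp only: divide_inverse power_inverse mult_zero_right)
  then have "\<forall>\<^sub>F k in sequentially. x / (- \<beta>) ^ k \<in> {ell \<beta><..<ell \<beta> + 1}"
    using e by (intro topological_tendstoD) auto
  then show ?thesis
    by (meson eventually_happens' sequentially_bot)
qed

text \<open>An expansion is a pair consisting of the list of digits before the point, most significant
  digit first, and the sequence of digits after the point.\<close>

definition neg_expansion :: "real \<Rightarrow> real \<Rightarrow> int list \<times> (nat \<Rightarrow> int)" where
  "neg_expansion \<beta> x =
     (let k = neg_shift \<beta> x; d = neg_digit \<beta> (x / (- \<beta>) ^ k)
      in (if k = 0 then [0] else map d [0..<k], \<lambda>i. d (k + i)))"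

text \<open>Since the list before the point is always finite, only the digits after the point matter.\<close>

definition finite_expansion :: "int list \<times> (nat \<Rightarrow> int) \<Rightarrow> bool" where
  "finite_expansion e \<longleftrightarrow> finite {i. snd e i \<noteq> 0}"

definition int_adjoin :: "real \<Rightarrow> real set" where
  "int_adjoin y = range (\<lambda>p :: int poly. poly (map_poly real_of_int p) y)"

definition property_neg_F :: "real \<Rightarrow> bool" where
  "property_neg_F \<beta> \<longleftrightarrow>
     (\<forall>x \<in> int_adjoin (inverse \<beta>). finite_expansion (neg_expansion \<beta> x))"

end

theory Submission
  imports Defs
begin

text \<open>
  Put \<open>\<gamma> = -\<beta>\<close> and let \<open>r\<^sub>0 = 1, r\<^sub>1, \<dots>, r\<^sub>d = 0\<close> be the Horner partial sums at \<open>\<gamma>\<close> of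
  \<open>X\<^sup>d + a\<^sub>1 X\<^sup>d\<^sup>-\<^sup>1 + \<dots> + a\<^sub>d\<close>, so that \<open>\<gamma> r\<^sub>j = r\<^sub>j\<^sub>+\<^sub>1 - a\<^sub>j\<^sub>+\<^sub>1\<close>. If
  \<open>x = \<Sum> z\<^sub>j r\<^sub>j\<close> with integers \<open>z\<^sub>j\<close>, then the transformation acts on the vector \<open>z\<close> as a shift
  register: it drops the last entry and inserts the only integer \<open>z'\<close> in front that puts the
  result into the fundamental interval. The hypothesis on the coefficients yields
  \<open>(\<beta> - 1) \<Sum> \<bar>r\<^sub>j\<bar> \<le> \<beta> - 2\<close> and \<open>(\<beta> + 1) \<Sum> max (-r\<^sub>j) 0 \<le> \<Sum> \<bar>r\<^sub>j\<bar>\<close> (sums over \<open>0 < j < d\<close>). By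
  the first bound, entries in \<open>[-M, M]\<close> with \<open>M > 0\<close> produce \<open>z' \<in> [-M, M - 1]\<close>; by both, entries
  in \<open>[-M, M - 1]\<close> produce \<open>z' \<in> [-(M - 1), M - 1]\<close>. So after \<open>2 d\<close> steps \<open>M\<close> has dropped by one,
  and eventually \<open>z = 0\<close>. Every orbit that starts in \<open>\<int>[\<beta>\<^sup>-\<^sup>1]\<close> reaches the lattice \<open>\<Sum> \<int> r\<^sub>j\<close>.
\<close>

section \<open>Horner partial sums\<close>

primrec horner :: "'a::comm_ring_1 \<Rightarrow> (nat \<Rightarrow> int) \<Rightarrow> nat \<Rightarrow> 'a" where
  "horner x a 0 = 1"
| "horner x a (Suc j) = of_int (a (Suc j)) + x * horner x a j"

lemma horner_conv_sum:
  "horner x a n = x ^ n + (\<Sum>i = 1..n. of_int (a i) * x ^ (n - i))"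
proof (induction n)
  case (Suc n)
  have "(\<Sum>i = 1..n. of_int (a i) * x ^ (Suc n - i)) = x * (\<Sum>i = 1..n. of_int (a i) * x ^ (n - i))"
    unfolding sum_distrib_left by (intro sum.cong refl) (simp add: Suc_diff_le mult_ac)
  then show ?case
    using Suc by (simp add: algebra_simps)
qed simp

text \<open>Passing to \<open>- x\<close> absorbs the alternating signs up to the global factor
  \<open>(-1) ^ n\<close>.\<close>

lemma horner_uminus_eq_0:
  fixes x :: "'a::comm_ring_1"
  assumes "x ^ n + (\<Sum>i = 1..n. (-1) ^ i * of_int (a i) * x ^ (n - i)) = 0"
  shows "horner (- x) a n = 0"
proof -
  have *: "(- x) ^ (n - i) = (-1) ^ n * ((-1) ^ i * x ^ (n - i))" if "i \<in> {1..n}" for i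
  proof -
    have "(- x) ^ (n - i) = (-1) ^ (n - i) * x ^ (n - i)"
      by (rule power_minus)
    also have "(-1 :: 'a) ^ (n - i) = (-1) ^ n * (-1) ^ i"
      using that by (auto simp: minus_one_power_iff)
    finally show ?thesis by (simp add: mult.assoc)
  qed
  have "(\<Sum>i = 1..n. of_int (a i) * (- x) ^ (n - i))
      = (-1) ^ n * (\<Sum>i = 1..n. (-1) ^ i * of_int (a i) * x ^ (n - i))"
    unfolding sum_distrib_left by (intro sum.cong refl) (simp only: * mult_ac)
  then have "horner (- x) a n
      = (-1) ^ n * (x ^ n + (\<Sum>i = 1..n. (-1) ^ i * of_int (a i) * x ^ (n - i)))"
    unfolding horner_conv_sum distrib_left by (metis power_minus)
  then show ?thesis
    using assms by simp
qed

text \<open>Positive parts of \<open>c\<close> pair with the upper bound on \<open>z\<close>,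
  negative parts with the lower one. Separate bounds \<open>A\<close> and \<open>B\<close> serve the
  asymmetric range below.\<close>

lemma sum_mult_mem_interval_le:
  fixes c z :: "nat \<Rightarrow> real"
  assumes "\<And>j. j < n \<Longrightarrow> - B \<le> z j \<and> z j \<le> A"
  shows "(\<Sum>j<n. c j * z j) \<le> A * (\<Sum>j<n. max (c j) 0) + B * (\<Sum>j<n. max (- c j) 0)"
  unfolding sum_distrib_left sum.distrib[symmetric]
proof (rule sum_mono)
  fix j assume "j \<in> {..<n}"
  then have z: "- B \<le> z j" "z j \<le> A"
    using assms by auto
  show "c j * z j \<le> A * max (c j) 0 + B * max (- c j) 0"
    using mult_left_mono[OF z(2), of "c j"] mult_left_mono_neg[OF z(1), of "c j"]
    by (cases "c j \<ge> 0") (auto simp: mult.commute)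
qed

section \<open>Orbits that reach 0\<close>

lemma neg_T_eq_0:
  assumes "\<beta> > 1"
  shows "neg_T \<beta> 0 = 0" "\<lfloor>- ell \<beta>\<rfloor> = 0"
proof -
  show "\<lfloor>- ell \<beta>\<rfloor> = 0"
    using assms by (simp add: ell_def floor_eq_iff)
  then show "neg_T \<beta> 0 = 0"
    by (simp add: neg_T_def)
qed

lemma funpow_neg_T_eq_0:
  assumes "\<beta> > 1" "(neg_T \<beta> ^^ n) x = 0" "n \<le> i"
  shows "(neg_T \<beta> ^^ i) x = 0"
  using assms(3)
  by (induction rule: dec_induct) (simp_all add: assms(2) neg_T_eq_0[OF assms(1)])

text \<open>Once an orbit is at 0 it stays there and emits the digit
  \<open>\<lfloor>- ell \<beta>\<rfloor> = 0\<close>.\<close>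

lemma finite_expansionI:
  assumes "\<beta> > 1" "(neg_T \<beta> ^^ n) (x / (- \<beta>) ^ neg_shift \<beta> x) = 0"
  shows "finite_expansion (neg_expansion \<beta> x)"
proof -
  let ?k = "neg_shift \<beta> x"
  have "neg_digit \<beta> (x / (- \<beta>) ^ ?k) (?k + i) = 0" if "n \<le> i" for i
    using funpow_neg_T_eq_0[OF assms, of "?k + i"] that
    by (simp add: neg_digit_def neg_T_eq_0[OF assms(1)])
  then have "{i. snd (neg_expansion \<beta> x) i \<noteq> 0} \<subseteq> {..<n}"
    by (auto simp: neg_expansion_def Let_def not_le[symmetric])
  then show ?thesis
    unfolding finite_expansion_def by (rule finite_subset) simp
qed

section \<open>Positive and negative parts of the Horner sums\<close>

locale dominant_negative_base =
  fixes \<beta> :: real and e :: nat and a :: "nat \<Rightarrow> int"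
  assumes beta_gt_1: "\<beta> > 1"
    and horner_eq_0: "horner (- \<beta>) a (Suc e) = 0"
    and coeff_nonneg: "\<And>i. i \<in> {1..Suc e} \<Longrightarrow> a i \<ge> 0"
    and dominant: "a 1 \<ge> 2 + (\<Sum>i = 2..Suc e. a i)"
begin

abbreviation r :: "nat \<Rightarrow> real" where
  "r \<equiv> horner (- \<beta>) a"

definition pos_weight :: real where
  "pos_weight = (\<Sum>j<e. max (r (Suc j)) 0)"

definition neg_weight :: real where
  "neg_weight = (\<Sum>j<e. max (- r (Suc j)) 0)"

text \<open>By the recursion, \<open>\<beta> * - r j\<close> is
  \<open>r (Suc j) - a (Suc j)\<close>, at most \<open>r (Suc j)\<close>, so each negative part is
  paid for by the positive part of the next sum. Reindexing gains \<open>r (Suc e) = 0\<close> and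
  loses \<open>r 1\<close>.\<close>

lemma neg_weight_le: "\<beta> * neg_weight \<le> pos_weight - max (r 1) 0"
proof -
  have "\<beta> * neg_weight \<le> (\<Sum>j<e. max (r (Suc (Suc j))) 0)"
    unfolding neg_weight_def sum_distrib_left
  proof (rule sum_mono)
    fix j assume "j \<in> {..<e}"
    then have "a (Suc (Suc j)) \<ge> 0"
      using coeff_nonneg by simp
    moreover have "\<beta> * - r (Suc j) = r (Suc (Suc j)) - real_of_int (a (Suc (Suc j)))"
      by (simp add: algebra_simps)
    ultimately show "\<beta> * max (- r (Suc j)) 0 \<le> max (r (Suc (Suc j))) 0"
      by (cases "r (Suc j) \<ge> 0") (simp_all add: max_def del: horner.simps(2))
  qed
  also have "\<dots> = pos_weight - max (r 1) 0"
    using sum.lessThan_Suc_shift[of "\<lambda>j. max (r (Suc j)) 0" e] horner_eq_0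
    by (simp add: pos_weight_def del: horner.simps(2))
  finally show ?thesis .
qed

text \<open>The same recursion with the opposite sign; now the coefficient stays in the
  bound.\<close>

lemma pos_weight_le:
  "\<beta> * pos_weight \<le> (\<Sum>i = 2..Suc e. real_of_int (a i)) + neg_weight - max (- r 1) 0"
proof -
  have "\<beta> * pos_weight \<le> (\<Sum>j<e. real_of_int (a (Suc (Suc j))) + max (- r (Suc (Suc j))) 0)"
    unfolding pos_weight_def sum_distrib_left
  proof (rule sum_mono)
    fix j assume "j \<in> {..<e}"
    then have "a (Suc (Suc j)) \<ge> 0"
      using coeff_nonneg by simp
    moreover have "\<beta> * r (Suc j) = real_of_int (a (Suc (Suc j))) - r (Suc (Suc j))"
      by simp
    ultimately show "\<beta> * max (r (Suc j)) 0 \<le> real_of_int (a (Suc (Suc j))) + max (- r (Suc (Suc j))) 0"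
      by (cases "r (Suc j) \<ge> 0") (simp_all add: max_def del: horner.simps(2))
  qed
  also have "\<dots> = (\<Sum>j<e. real_of_int (a (Suc (Suc j)))) + (neg_weight - max (- r 1) 0)"
    using sum.lessThan_Suc_shift[of "\<lambda>j. max (- r (Suc j)) 0" e] horner_eq_0
    by (simp add: neg_weight_def sum.distrib del: horner.simps(2))
  also have "(\<Sum>j<e. real_of_int (a (Suc (Suc j)))) = (\<Sum>i = 2..Suc e. real_of_int (a i))"
    by (rule sum.reindex_bij_witness[of _ "\<lambda>i. i - 2" "\<lambda>j. j + 2"]) auto
  finally show ?thesis by simp
qed

text \<open>Adding the two bounds leaves \<open>- \<bar>r 1\<bar>\<close>, at most
  \<open>- r 1 = \<beta> - a 1\<close>; dominance of \<open>a 1\<close> does the rest.\<close>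

lemma total_weight_le: "(\<beta> - 1) * (pos_weight + neg_weight) \<le> \<beta> - 2"
proof -
  have "(\<beta> - 1) * (pos_weight + neg_weight) \<le> (\<Sum>i = 2..Suc e. real_of_int (a i)) - r 1"
    using pos_weight_le neg_weight_le by (simp add: algebra_simps del: horner.simps(2))
  also have "real_of_int (a 1) \<ge> 2 + (\<Sum>i = 2..Suc e. real_of_int (a i))"
    using of_int_le_iff[where ?'a = real, THEN iffD2, OF dominant]
    by (simp del: sum.cl_ivl_Suc)
  then have "(\<Sum>i = 2..Suc e. real_of_int (a i)) - r 1 \<le> \<beta> - 2"
    by simp
  finally show ?thesis .
qed

lemma total_weight_lt_1: "pos_weight + neg_weight < 1"
proof -
  have "(\<beta> - 1) * (pos_weight + neg_weight) < (\<beta> - 1) * 1"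
    using total_weight_le by simp
  then show ?thesis
    using beta_gt_1 by (simp only: mult_less_cancel_left_pos diff_gt_0_iff_gt)
qed

text \<open>As \<open>\<beta> * neg_weight\<close> is at most \<open>pos_weight\<close>,
  \<open>(\<beta> + 1) * neg_weight\<close> is at most the total weight. The bound
  \<open>1 / (\<beta> + 1)\<close> is \<open>ell \<beta> + 1\<close>, the right end of the
  interval.\<close>

lemma neg_weight_lt: "neg_weight < 1 / (\<beta> + 1)"
proof -
  have "(\<beta> + 1) * neg_weight < 1"
    using neg_weight_le total_weight_lt_1 by (simp add: algebra_simps del: horner.simps(2))
  then show ?thesis
    using beta_gt_1 by (simp add: field_simps)
qed

section \<open>The lattice and the shift register\<close>

definition lattice_val :: "(nat \<Rightarrow> int) \<Rightarrow> real" where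
  "lattice_val z = (\<Sum>j<Suc e. r j * of_int (z j))"

text \<open>Since \<open>- \<beta> * r j = r (Suc j) - a (Suc j)\<close> and \<open>r 0 = 1\<close>,
  multiplication by \<open>- \<beta>\<close> shifts the entries and collects the coefficients at
  index 0. The entry pushed to index \<open>Suc e\<close> is dropped in effect, as
  \<open>lattice_val\<close> does not see it.\<close>

definition shift_in :: "int \<Rightarrow> (nat \<Rightarrow> int) \<Rightarrow> nat \<Rightarrow> int" where
  "shift_in c z = case_nat (c - (\<Sum>j<Suc e. a (Suc j) * z j)) z"

lemma lattice_val_shift_in: "lattice_val (shift_in c z) = - \<beta> * lattice_val z + of_int c"
proof -
  have "- \<beta> * lattice_val z = (\<Sum>j<Suc e. (r (Suc j) - of_int (a (Suc j))) * of_int (z j))"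
    unfolding lattice_val_def sum_distrib_left by (simp add: mult.assoc)
  also have "\<dots> = (\<Sum>j<Suc e. r (Suc j) * of_int (z j)) - of_int (\<Sum>j<Suc e. a (Suc j) * z j)"
    by (simp only: left_diff_distrib sum_subtractf of_int_sum of_int_mult)
  also have "(\<Sum>j<Suc e. r (Suc j) * of_int (z j)) = (\<Sum>j<e. r (Suc j) * of_int (z j))"
    using horner_eq_0 by (simp del: horner.simps(2))
  finally show ?thesis
    unfolding lattice_val_def sum.lessThan_Suc_shift[of _ e] shift_in_def
    by (simp del: horner.simps(2))
qed

definition T_step :: "(nat \<Rightarrow> int) \<Rightarrow> nat \<Rightarrow> int" where
  "T_step z = shift_in (- \<lfloor>- \<beta> * lattice_val z - ell \<beta>\<rfloor>) z"

lemma T_step_Suc: "T_step z (Suc j) = z j"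
  by (simp add: T_step_def shift_in_def)

lemma lattice_val_T_step: "lattice_val (T_step z) = neg_T \<beta> (lattice_val z)"
  by (simp add: T_step_def lattice_val_shift_in neg_T_def)

lemma lattice_val_funpow_T_step:
  "lattice_val ((T_step ^^ n) z) = (neg_T \<beta> ^^ n) (lattice_val z)"
  by (induction n) (simp_all add: lattice_val_T_step)

text \<open>\<open>w z\<close> is the contribution of the shifted old entries. As
  \<open>r 0 = 1\<close>, membership in the fundamental interval confines the new entry to a
  half-open window of length 1.\<close>

lemma T_step_0_bounds:
  defines "w \<equiv> \<lambda>z. \<Sum>j<e. r (Suc j) * of_int (z j)"
  shows "1 / (\<beta> + 1) - 1 - w z \<le> of_int (T_step z 0)" "of_int (T_step z 0) < 1 / (\<beta> + 1) - w z"
proof -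
  have "lattice_val (T_step z) = of_int (T_step z 0) + w z"
    unfolding lattice_val_def sum.lessThan_Suc_shift[of _ e] w_def
    by (simp add: T_step_Suc del: horner.simps(2))
  moreover have "ell \<beta> = 1 / (\<beta> + 1) - 1"
    using beta_gt_1 by (simp add: ell_def field_simps)
  moreover have "lattice_val (T_step z) \<in> {ell \<beta>..<ell \<beta> + 1}"
    unfolding lattice_val_T_step by (rule neg_T_range)
  ultimately show "1 / (\<beta> + 1) - 1 - w z \<le> of_int (T_step z 0)"
    "of_int (T_step z 0) < 1 / (\<beta> + 1) - w z"
    by simp_all
qed

section \<open>Range of the inserted entry\<close>

lemma weighted_sum_le:
  fixes z :: "nat \<Rightarrow> int"
  assumes "\<And>j. j < Suc e \<Longrightarrow> z j \<in> {- B..A}"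
  shows "(\<Sum>j<e. r (Suc j) * of_int (z j)) \<le> of_int A * pos_weight + of_int B * neg_weight"
  unfolding pos_weight_def neg_weight_def
proof (rule sum_mult_mem_interval_le)
  fix j assume "j < e"
  then have "- B \<le> z j" "z j \<le> A"
    using assms[of j] by auto
  then show "- real_of_int B \<le> real_of_int (z j) \<and> real_of_int (z j) \<le> real_of_int A"
    by linarith
qed

lemma T_step_0_symmetric:
  assumes z: "\<And>j. j < Suc e \<Longrightarrow> z j \<in> {- M..M}" and M: "M \<ge> 1"
  shows "T_step z 0 \<in> {- M..M - 1}"
proof -
  define w where "w = (\<Sum>j<e. r (Suc j) * of_int (z j))"
  define s where "s = pos_weight + neg_weight"
  have s: "s < 1" "(\<beta> - 1) * s \<le> \<beta> - 2"
    using total_weight_lt_1 total_weight_le by (simp_all add: s_def)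
  have "w \<le> M * s"
    using weighted_sum_le[of z M M] z by (simp add: w_def s_def distrib_left)
  moreover have "- w \<le> M * s"
    using weighted_sum_le[of "\<lambda>j. - z j" M M] z
    by (simp add: w_def s_def distrib_left sum_negf del: horner.simps(2)) fastforce
  moreover have "M * s \<le> real_of_int M * 1"
    using s M by (intro mult_left_mono) auto
  \<comment> \<open>This margin excludes \<open>M\<close> as new entry. It rests on
    \<open>total_weight_le\<close>, rewritten as
    \<open>1 / (\<beta> - 1) \<le> 1 - s\<close>.\<close>
  moreover have "M * s + 1 / (\<beta> + 1) < M"
  proof -
    have "1 / (\<beta> + 1) < 1 / (\<beta> - 1)"
      using beta_gt_1 by (simp add: frac_less2)
    also have "1 / (\<beta> - 1) \<le> 1 - s"
      using s(2) beta_gt_1 by (simp add: field_simps)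
    also have "\<dots> \<le> M * (1 - s)"
      using s M mult_right_mono[of 1 "real_of_int M" "1 - s"] by simp
    finally show ?thesis by (simp add: algebra_simps)
  qed
  moreover have "1 / (\<beta> + 1) > 0"
    using beta_gt_1 by simp
  ultimately have "real_of_int (T_step z 0) > - real_of_int M - 1" "real_of_int (T_step z 0) < M"
    using T_step_0_bounds[of z] unfolding w_def by linarith+
  then show ?thesis by auto
qed

text \<open>Only the value \<open>- M\<close> remains to be excluded. The smaller upper bound on the
  entries gives \<open>w \<le> M - 1 + neg_weight\<close>, and \<open>neg_weight_lt\<close> then
  lifts the whole window above \<open>- M\<close>.\<close>

lemma T_step_0_asymmetric:
  assumes z: "\<And>j. j < Suc e \<Longrightarrow> z j \<in> {- M..M - 1}" and M: "M \<ge> 1"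
  shows "T_step z 0 \<in> {- (M - 1)..M - 1}"
proof -
  define w where "w = (\<Sum>j<e. r (Suc j) * of_int (z j))"
  define s where "s = pos_weight + neg_weight"
  have "w \<le> (real_of_int M - 1) * s + neg_weight"
    using weighted_sum_le[of z M "M - 1"] z by (simp add: w_def s_def algebra_simps)
  also have "(real_of_int M - 1) * s \<le> (real_of_int M - 1) * 1"
    using M total_weight_lt_1 by (intro mult_left_mono) (auto simp: s_def)
  finally have "w \<le> real_of_int M - 1 + neg_weight"
    by simp
  then have "real_of_int (T_step z 0) > - real_of_int M"
    using T_step_0_bounds(1)[of z] neg_weight_lt unfolding w_def by linarith
  moreover have "T_step z 0 \<in> {- M..M - 1}"
    using z M by (intro T_step_0_symmetric) fastforce+
  ultimately show ?thesis by auto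
qed

section \<open>Descent to the zero vector\<close>

lemma funpow_T_step_mem:
  assumes step: "\<And>z. (\<And>j. j < Suc e \<Longrightarrow> z j \<in> A) \<Longrightarrow> T_step z 0 \<in> B"
    and "B \<subseteq> A" and z: "\<And>j. j < Suc e \<Longrightarrow> z j \<in> A" and j: "j < Suc e"
  shows "(T_step ^^ Suc e) z j \<in> B"
proof -
  \<comment> \<open>After \<open>n\<close> steps the first \<open>n\<close> entries are freshly
    inserted, hence in \<open>B\<close>; \<open>B \<subseteq> A\<close> keeps \<open>step\<close>
    applicable.\<close>
  have "\<forall>j<Suc e. (T_step ^^ n) z j \<in> A \<and> (j < n \<longrightarrow> (T_step ^^ n) z j \<in> B)" for n
  proof (induction n)
    case (Suc n)
    show ?case
    proof (intro allI impI)
      fix j assume "j < Suc e"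
      with Suc step[of "(T_step ^^ n) z"] \<open>B \<subseteq> A\<close>
      show "(T_step ^^ Suc n) z j \<in> A \<and> (j < Suc n \<longrightarrow> (T_step ^^ Suc n) z j \<in> B)"
        by (cases j) (auto simp: T_step_Suc)
    qed
  qed (use z in simp)
  then show ?thesis using j by blast
qed

lemma lattice_orbit_reaches_0:
  assumes "\<And>j. j < Suc e \<Longrightarrow> z j \<in> {- int M..int M}"
  shows "\<exists>n. (neg_T \<beta> ^^ n) (lattice_val z) = 0"
  using assms
proof (induction M arbitrary: z)
  case 0
  then have "lattice_val z = 0"
    by (simp add: lattice_val_def)
  then show ?case
    by (intro exI[of _ 0]) simp
next
  case (Suc M)
  let ?z' = "(T_step ^^ Suc e) ((T_step ^^ Suc e) z)"
  \<comment> \<open>The first full pass removes the entry \<open>Suc M\<close>, the second one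
    \<open>- Suc M\<close>.\<close>
  have 1: "(T_step ^^ Suc e) z j \<in> {- int (Suc M)..int (Suc M) - 1}" if "j < Suc e" for j
    by (rule funpow_T_step_mem[where z = z, OF T_step_0_symmetric _ Suc.prems that]) auto
  have "?z' j \<in> {- (int (Suc M) - 1)..int (Suc M) - 1}" if "j < Suc e" for j
    by (rule funpow_T_step_mem[where z = "(T_step ^^ Suc e) z", OF T_step_0_asymmetric _ 1 that]) auto
  then have "\<And>j. j < Suc e \<Longrightarrow> ?z' j \<in> {- int M..int M}"
    by (simp del: funpow.simps)
  from Suc.IH[OF this] obtain n where "(neg_T \<beta> ^^ n) (lattice_val ?z') = 0" ..
  then have "(neg_T \<beta> ^^ (n + Suc e + Suc e)) (lattice_val z) = 0"
    by (simp only: lattice_val_funpow_T_step funpow_add o_apply)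
  then show ?case ..
qed

lemma range_lattice_val_reaches_0:
  assumes "x \<in> range lattice_val"
  shows "\<exists>n. (neg_T \<beta> ^^ n) x = 0"
proof -
  from assms obtain z where x: "x = lattice_val z" by blast
  define M where "M = (\<Sum>j<Suc e. nat \<bar>z j\<bar>)"
  have "z j \<in> {- int M..int M}" if "j < Suc e" for j
  proof -
    have "nat \<bar>z j\<bar> \<le> M"
      unfolding M_def using that by (intro member_le_sum) auto
    then show ?thesis by auto
  qed
  then show ?thesis
    unfolding x by (rule lattice_orbit_reaches_0)
qed

section \<open>Reduction of \<open>int_adjoin (inverse \<beta>)\<close> to the lattice\<close>

lemma lattice_add:
  assumes "x \<in> range lattice_val" "y \<in> range lattice_val"
  shows "x + y \<in> range lattice_val"
proof -
  have "lattice_val u + lattice_val v = lattice_val (\<lambda>j. u j + v j)" for u v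
    by (simp only: lattice_val_def of_int_add distrib_left sum.distrib)
  then show ?thesis using assms by auto
qed

text \<open>An integer arises by shifting it into the zero vector, and \<open>shift_in 0\<close>
  realises multiplication by \<open>- \<beta>\<close>.\<close>

lemma lattice_of_int_mult_power: "of_int c * (- \<beta>) ^ n \<in> range lattice_val"
proof (induction n)
  case 0
  have "lattice_val (shift_in c (\<lambda>_. 0)) = of_int c"
    unfolding lattice_val_shift_in by (simp add: lattice_val_def)
  then show ?case by (metis power_0 mult_1_right rangeI)
next
  case (Suc n)
  then obtain z where "of_int c * (- \<beta>) ^ n = lattice_val z" by blast
  then have "of_int c * (- \<beta>) ^ Suc n = lattice_val (shift_in 0 z)"
    unfolding lattice_val_shift_in by (simp add: algebra_simps)
  then show ?case by blast
qed

text \<open>One step multiplies by \<open>- \<beta>\<close> and subtracts an integer, so it uses up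
  one factor of the power, at the cost of a lattice element.\<close>

lemma reaches_0_of_mult_power:
  assumes "(- \<beta>) ^ m * x \<in> range lattice_val"
  shows "\<exists>n. (neg_T \<beta> ^^ n) x = 0"
  using assms
proof (induction m arbitrary: x)
  case 0
  then show ?case
    using range_lattice_val_reaches_0 by simp
next
  case (Suc m)
  let ?c = "\<lfloor>- \<beta> * x - ell \<beta>\<rfloor>"
  have "(- \<beta>) ^ m * neg_T \<beta> x = (- \<beta>) ^ Suc m * x + of_int (- ?c) * (- \<beta>) ^ m"
    by (simp add: neg_T_def algebra_simps)
  also have "\<dots> \<in> range lattice_val"
    by (rule lattice_add[OF Suc.prems lattice_of_int_mult_power])
  finally obtain n where "(neg_T \<beta> ^^ n) (neg_T \<beta> x) = 0"
    using Suc.IH by blast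
  then have "(neg_T \<beta> ^^ Suc n) x = 0"
    by (simp only: funpow_Suc_right o_apply)
  then show ?case ..
qed

lemma int_adjoin_mult_power:
  assumes "x \<in> int_adjoin (inverse \<beta>)"
  shows "\<exists>m. (- \<beta>) ^ m * x \<in> range lattice_val"
proof -
  have "\<exists>m. (- \<beta>) ^ m * poly (map_poly real_of_int p) (inverse \<beta>) \<in> range lattice_val" for p
  proof (induction p)
    case 0
    show ?case
      using lattice_of_int_mult_power[of 0 0] by simp
  next
    case (pCons c p)
    then obtain m z where
      z: "(- \<beta>) ^ m * poly (map_poly real_of_int p) (inverse \<beta>) = lattice_val z" by blast
    \<comment> \<open>\<open>inverse \<beta>\<close> is minus the inverse of
      \<open>- \<beta>\<close>, hence the sign in \<open>- z j\<close>.\<close>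
    have "(- \<beta>) ^ Suc m * poly (map_poly real_of_int (pCons c p)) (inverse \<beta>)
        = of_int c * (- \<beta>) ^ Suc m + lattice_val (\<lambda>j. - z j)"
      using beta_gt_1 z[symmetric]
      by (simp add: map_poly_pCons algebra_simps lattice_val_def sum_negf
          del: horner.simps(2) sum.lessThan_Suc)
    also have "\<dots> \<in> range lattice_val"
      by (intro lattice_add lattice_of_int_mult_power rangeI)
    finally show ?case ..
  qed
  then show ?thesis
    using assms by (auto simp: int_adjoin_def)
qed

lemma property_neg_F: "property_neg_F \<beta>"
  unfolding property_neg_F_def
proof
  fix x assume "x \<in> int_adjoin (inverse \<beta>)"
  then obtain m where "(- \<beta>) ^ m * x \<in> range lattice_val"
    using int_adjoin_mult_power by blast
  moreover define k where "k = neg_shift \<beta> x"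
  \<comment> \<open>Scaling \<open>x\<close> into the interval only raises the power that clears
    denominators.\<close>
  ultimately have "(- \<beta>) ^ (m + k) * (x / (- \<beta>) ^ k) \<in> range lattice_val"
    using beta_gt_1 by (simp add: power_add)
  then obtain n where "(neg_T \<beta> ^^ n) (x / (- \<beta>) ^ k) = 0"
    using reaches_0_of_mult_power by blast
  then show "finite_expansion (neg_expansion \<beta> x)"
    unfolding k_def by (rule finite_expansionI[OF beta_gt_1])
qed

end

theorem theorem4:
  fixes \<beta> :: real and d :: nat and a :: "nat \<Rightarrow> int"
  assumes "\<beta> > 1"
    and "\<beta> ^ d + (\<Sum>i = 1..d. (-1) ^ i * real_of_int (a i) * \<beta> ^ (d - i)) = 0"
    and "\<And>i. i \<in> {1..d} \<Longrightarrow> a i \<ge> 0"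
    and "a 1 \<ge> 2 + (\<Sum>i = 2..d. a i)"
  shows "property_neg_F \<beta>"
proof (cases d)
  case 0
  \<comment> \<open>In degree 0 the equation would read \<open>1 = 0\<close>.\<close>
  then show ?thesis using assms(2) by simp
next
  case (Suc e)
  interpret dominant_negative_base \<beta> e a
    using assms horner_uminus_eq_0[OF assms(2)] unfolding Suc by unfold_locales
  show ?thesis by (rule property_neg_F)
qed

end
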